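(* Let $G=(V,E)$ be a directed graph and let $\mathscr H$ be its set of directed Hamiltonian cycles. For a vertex $v$ and a vertex subset $X\subseteq V$, let $d_v(X)$ denote the number of directed edges from $v$ to a vertex in $X$. For every integer $K\geq 2$, \[ |\mathscr H| = \frac{1}{K}\sum_{Z,Y_1,\ldots,Y_K} (-1)^{|V\setminus Z|}\biggl(\prod_{z\in Z} d_z(V\setminus Z)\biggr)\prod_{k=1}^K\biggl(\prod_{y\in Y_k} d_y(Y_k)\biggr) \pmod K, \] where the sum is over all ordered $(K+1)$-partitions $(Z,Y_1,\ldots,Y_K)$ of $V$ (pairwise disjoint sets, possibly empty, whose union is $V$).
   Context: A directed Hamiltonian cycle is a directed cycle in $G$ visiting every vertex exactly once; $\mathscr H$ is the set of these (viewed as edge sets).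
   Formalization: The sign is (-1)^{|Z|} instead of (-1)^{|V∖Z|}, since the printed formula fails for the directed triangle with K=3 (it gives -1, not 1, mod 3); V is assumed nonempty, since for empty V the sum is 1, not divisible by K. *)

theory Defs
  imports
    "Graph_Theory.Arc_Walk"
    "HOL-Library.FuncSet"
    "HOL-Library.Disjoint_Sets"
    "HOL-Number_Theory.Cong"
begin

text \<open>
  The library's cycles are nonempty closed arc walks that repeat no vertex except for the
  coinciding endpoints; the tails of the arcs are exactly the vertices visited. Passing from the
  arc list to its set identifies the rotations of a cycle. A 2-cycle \<open>u, v, u\<close> counts as a cycle,
  and so does a loop.
\<close>

definition hamiltonian_cycles :: "('a, 'b) pre_digraph \<Rightarrow> 'b set set" where
  "hamiltonian_cycles G = {set p |p. pre_digraph.cycle G p \<and> tail G ` set p = verts G}"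

definition out_deg_into :: "('a, 'b) pre_digraph \<Rightarrow> 'a \<Rightarrow> 'a set \<Rightarrow> nat" where
  "out_deg_into G v X = card {e \<in> arcs G. tail G e = v \<and> head G e \<in> X}"

text \<open>The families \<open>Y\<close> are extensional, so that each ordered partition occurs exactly once.\<close>

definition ordered_partitions :: "'a set \<Rightarrow> nat \<Rightarrow> ('a set \<times> (nat \<Rightarrow> 'a set)) set" where
  "ordered_partitions V K =
     {(Z, Y). Z \<subseteq> V \<and> Y \<in> {1..K} \<rightarrow>\<^sub>E Pow V \<and> disjoint_family_on Y {1..K} \<and>
        (\<forall>k\<in>{1..K}. Z \<inter> Y k = {}) \<and> Z \<union> (\<Union>k\<in>{1..K}. Y k) = V}"

text \<open>
  In the sum over ordered partitions the sign has to be \<open>(-1)\<^bsup>card Z\<^esup>\<close>. With exponent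
  \<open>card (V - Z)\<close> instead, the sum is multiplied by \<open>(-1)\<^bsup>card V\<^esup>\<close>, and the congruence
  fails for the directed triangle and \<open>K = 3\<close>: that sum is \<open>- 3\<close>, and \<open>- 3 / 3 = - 1\<close> is not
  congruent to the number \<open>1\<close> of Hamiltonian cycles modulo \<open>3\<close>. The null graph has to be
  excluded, since there the sum is \<open>1\<close>, which is not divisible by \<open>K\<close>.
\<close>

end

theory Submission
  imports Defs "HOL-Combinatorics.Orbits"
begin

text \<open>
  Expanding the products of out-degrees turns the sum into a sum over all choices \<open>f\<close> of one arc
  leaving each vertex, together with the ordered partitions compatible with \<open>h = head \<circ> f\<close>. In a
  compatible partition \<open>Z\<close> is an arbitrary set of vertices outside the image of \<open>h\<close>, and each \<open>Y k\<close> is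
  a union of weak components of \<open>h\<close> on \<open>V - Z\<close>. By the signs only the \<open>h\<close> that permute \<open>V\<close>
  survive, and such an \<open>h\<close> contributes \<open>K\<close> to the number of its cycles. After division by \<open>K\<close>,
  modulo \<open>K\<close> this counts the \<open>h\<close> with a single cycle, which are the Hamiltonian cycles.
\<close>

section \<open>Permutations of a finite set and their orbits\<close>

lemma sum_of_bool_eq_card:
  assumes "finite A"
  shows "(\<Sum>x\<in>A. of_bool (P x)) = (of_nat (card {x \<in> A. P x}) :: 'a :: semiring_1)"
  using assms by (simp add: of_bool_def sum.If_cases Int_def)

lemma cyclic_on_image_eq: "f ` S = S" if "cyclic_on f S"
proof
  show "f ` S \<subseteq> S" using cyclic_on_inI[OF that] by blast
  show "S \<subseteq> f ` S"
  proof
    fix x assume "x \<in> S"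
    then have "x \<in> orbit f x" using that by (simp add: orbit_cyclic_eq3)
    then show "x \<in> f ` S"
      by (cases rule: orbit.cases) (use \<open>x \<in> S\<close> orbit_cyclic_eq3[OF that] in auto)
  qed
qed

text \<open>A surjection of a finite set onto itself is injective. The restriction supplies the
  identity outside \<open>S\<close> that \<open>permutes\<close> demands, which successor maps
  \<open>head G \<circ> f\<close> need not satisfy.\<close>

lemma perm_restrict_permutes:
  assumes "finite S" "f ` S = S"
  shows "perm_restrict f S permutes S"
proof (rule bij_imp_permutes)
  have "bij_betw f S S"
    using assms by (simp add: bij_betw_def eq_card_imp_inj_on)
  then show "bij_betw (perm_restrict f S) S S"
    by (simp add: perm_restrict_def cong: bij_betw_cong)
qed (simp add: perm_restrict_def)

text \<open>An invariant function is constant on orbits, so it factors uniquely through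
  \<open>orbit h\<close> as an arbitrary function on the set of orbits.\<close>

lemma card_orbit_invariant_funcset:
  assumes "finite V" and h: "h permutes V"
  shows "card {c \<in> V \<rightarrow>\<^sub>E C. \<forall>v\<in>V. c (h v) = c v} = card C ^ card (orbit h ` V)"
proof -
  let ?I = "{c \<in> V \<rightarrow>\<^sub>E C. \<forall>v\<in>V. c (h v) = c v}"
  let ?F = "\<lambda>g. \<lambda>v\<in>V. g (orbit h v)"
  have perm: "permutation h"
    using assms by (auto simp: permutation_permutes)
  note hV = permutes_in_image[OF h]
  have const: "c w = c v" if "c \<in> ?I" "v \<in> V" "w \<in> orbit h v" for c v w
    using that(3)
  proof induction
    case base
    show ?case using that by auto
  next
    case (step y)
    moreover have "y \<in> V"
      using permutes_orbit_subset[OF h \<open>v \<in> V\<close>] step by auto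
    ultimately show ?case using that by auto
  qed
  have "bij_betw ?F (orbit h ` V \<rightarrow>\<^sub>E C) ?I"
    unfolding bij_betw_def
  proof (intro conjI subset_antisym subsetI)
    show "inj_on ?F (orbit h ` V \<rightarrow>\<^sub>E C)"
    proof (rule inj_onI)
      fix g g' assume g: "g \<in> orbit h ` V \<rightarrow>\<^sub>E C" "g' \<in> orbit h ` V \<rightarrow>\<^sub>E C" and eq: "?F g = ?F g'"
      show "g = g'"
      proof (rule PiE_ext[OF g])
        fix A assume "A \<in> orbit h ` V"
        then obtain v where "v \<in> V" "A = orbit h v" by blast
        then show "g A = g' A" using fun_cong[OF eq, of v] by simp
      qed
    qed
  next
    fix c assume "c \<in> ?F ` (orbit h ` V \<rightarrow>\<^sub>E C)"
    then show "c \<in> ?I"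
      by (auto simp: hV permutation_orbit_step[OF perm])
  next
    fix c assume c: "c \<in> ?I"
    \<comment> \<open>By \<open>const\<close> the value does not depend on the representative
      chosen.\<close>
    let ?g = "\<lambda>A\<in>orbit h ` V. c (SOME w. w \<in> A)"
    have g: "?g (orbit h v) = c v" if "v \<in> V" for v
      using that const[OF c that someI[of "\<lambda>w. w \<in> orbit h v" v]]
        permutation_self_in_orbit[OF perm] by auto
    have "?g \<in> orbit h ` V \<rightarrow>\<^sub>E C"
      using c g by fastforce
    moreover have "c = ?F ?g"
    proof
      fix v
      have "c \<in> V \<rightarrow>\<^sub>E C" using c by blast
      from PiE_arb[OF this, of v] show "c v = ?F ?g v"
        using g[of v] by (cases "v \<in> V") simp_all
    qed
    ultimately show "c \<in> ?F ` (orbit h ` V \<rightarrow>\<^sub>E C)" by blast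
  qed
  then have "card ?I = card (orbit h ` V \<rightarrow>\<^sub>E C)"
    by (simp add: bij_betw_same_card)
  then show ?thesis
    using assms by (simp add: card_PiE)
qed

text \<open>Each vertex lies in its own orbit and orbits stay inside \<open>V\<close>, so a single
  orbit must be all of \<open>V\<close>.\<close>

lemma card_orbits_eq_1_iff:
  assumes "finite V" and h: "h permutes V"
  shows "card (orbit h ` V) = 1 \<longleftrightarrow> cyclic_on h V"
proof
  have self: "v \<in> orbit h v" for v
    using assms by (intro permutation_self_in_orbit) (auto simp: permutation_permutes)
  assume "card (orbit h ` V) = 1"
  then obtain A where A: "orbit h ` V = {A}"
    by (rule card_1_singletonE)
  then have "A \<in> orbit h ` V" by simp
  then obtain x where x: "x \<in> V" "orbit h x = A" by blast
  have "V = orbit h x"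
    using A x self permutes_orbit_subset[OF h x(1)] by blast
  then show "cyclic_on h V" using x by (auto simp: cyclic_on_def)
next
  assume "cyclic_on h V"
  then have "orbit h ` V = {V}"
    unfolding cyclic_on_alldef by auto
  then show "card (orbit h ` V) = 1" by simp
qed

section \<open>Signed sums over admissible colourings\<close>

text \<open>
  An ordered partition \<open>(Z, Y)\<close> is encoded as the colouring with value \<open>0\<close> on \<open>Z\<close> and \<open>k\<close> on \<open>Y k\<close>.
\<close>
definition admissible_colouring :: "'a set \<Rightarrow> ('a \<Rightarrow> 'a) \<Rightarrow> ('a \<Rightarrow> nat) \<Rightarrow> bool" where
  "admissible_colouring V h c \<longleftrightarrow> (\<forall>v\<in>V. c (h v) \<noteq> 0 \<and> c v \<in> {0, c (h v)})"

text \<open>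
  A vertex \<open>l\<close> outside the image of \<open>h\<close> may be coloured either \<open>0\<close> or like \<open>h l\<close>; switching
  between the two reverses the sign.
\<close>
lemma sum_admissible_eq_0:
  assumes "finite V" and h: "h \<in> V \<rightarrow> V" and l: "l \<in> V" "l \<notin> h ` V"
  shows "(\<Sum>c | c \<in> V \<rightarrow>\<^sub>E {0..K} \<and> admissible_colouring V h c.
           \<Prod>v\<in>V. if c v = 0 then - 1 else (1 :: int)) = 0"
    (is "(\<Sum>c\<in>?A. ?w c) = 0")
proof -
  let ?t = "\<lambda>c. c(l := if c l = 0 then c (h l) else 0)"
  \<comment> \<open>As no vertex maps to \<open>l\<close>, the colour of \<open>l\<close> enters
    only the condition at \<open>l\<close> itself, so \<open>?t\<close> preserves
    admissibility.\<close>
  have hl: "h v \<noteq> l" "h v \<in> V" if "v \<in> V" for v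
    using that h l by auto
  have tt: "?t (?t c) = c" if "c \<in> ?A" for c
    using that l hl[of l] by (auto simp: admissible_colouring_def fun_eq_iff)
  have tA: "?t c \<in> ?A" if "c \<in> ?A" for c
  proof -
    have "c \<in> V \<rightarrow>\<^sub>E {0..K}" and adm: "admissible_colouring V h c"
      using that by auto
    then have "?t c \<in> V \<rightarrow>\<^sub>E {0..K}"
      using l hl[of l] by (auto simp: PiE_iff extensional_def)
    moreover have "admissible_colouring V h (?t c)"
      using adm l hl by (auto simp: admissible_colouring_def)
    ultimately show ?thesis by auto
  qed
  have wt: "?w (?t c) = - ?w c" if "c \<in> ?A" for c
  proof -
    have "c (h l) \<noteq> 0"
      using that l by (auto simp: admissible_colouring_def)
    moreover have "(\<Prod>v\<in>V - {l}. if ?t c v = 0 then - 1 else (1 :: int)) =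
        (\<Prod>v\<in>V - {l}. if c v = 0 then - 1 else 1)"
      by (rule prod.cong) auto
    ultimately show ?thesis
      using assms by (simp add: prod.remove[where x = l])
  qed
  have "(\<Sum>c\<in>?A. ?w c) = (\<Sum>c\<in>?A. - ?w c)"
  proof (rule sum.reindex_bij_witness)
    fix c assume c: "c \<in> ?A"
    show "?t (?t c) = c" "?t (?t c) = c" "?t c \<in> ?A" "?t c \<in> ?A"
      by (fact tt[OF c] tA[OF c])+
    show "- ?w (?t c) = ?w c"
      unfolding wt[OF c] by (rule minus_minus)
  qed
  then show ?thesis by (simp add: sum_negf)
qed

text \<open>Every vertex is some \<open>h u\<close> and therefore has a nonzero colour. Hence all
  weights are 1, and admissibility reduces to invariance under \<open>h\<close>: one of
  \<open>K\<close> colours per orbit.\<close>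

lemma sum_admissible_eq_power:
  assumes "finite V" and h: "h permutes V"
  shows "(\<Sum>c | c \<in> V \<rightarrow>\<^sub>E {0..K} \<and> admissible_colouring V h c.
           \<Prod>v\<in>V. if c v = 0 then - 1 else (1 :: int)) = int K ^ card (orbit h ` V)"
    (is "(\<Sum>c\<in>?A. ?w c) = _")
proof -
  have surj: "h ` V = V" using h by (rule permutes_image)
  have nz: "c v \<noteq> 0" if "c \<in> ?A" "v \<in> V" for c v
  proof -
    from that surj obtain u where "u \<in> V" "v = h u" by blast
    then show ?thesis using that by (auto simp: admissible_colouring_def)
  qed
  have "?A = {c \<in> V \<rightarrow>\<^sub>E {1..K}. \<forall>v\<in>V. c (h v) = c v}" (is "_ = ?I")
  proof (intro subset_antisym subsetI)
    fix c assume c: "c \<in> ?A"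
    have "c \<in> V \<rightarrow>\<^sub>E {1..K}"
      using c nz[OF c] by (auto simp: PiE_iff Suc_le_eq)
    moreover have "c (h v) = c v" if "v \<in> V" for v
      using c nz[OF c that] that by (auto simp: admissible_colouring_def)
    ultimately show "c \<in> ?I" by auto
  next
    fix c assume "c \<in> ?I"
    then show "c \<in> ?A"
      by (fastforce simp: admissible_colouring_def PiE_iff)
  qed
  moreover have "(\<Sum>c\<in>?A. ?w c) = (\<Sum>c\<in>?A. 1)"
  proof (intro sum.cong prod.neutral ballI refl)
    fix c v assume "c \<in> ?A" "v \<in> V"
    then show "(if c v = 0 then - 1 else (1 :: int)) = 1" using nz[of c v] by simp
  qed
  ultimately show ?thesis
    using card_orbit_invariant_funcset[OF assms, of "{1..K}"] by simp
qed

section \<open>Walks that follow a successor map\<close>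

lemma (in pre_digraph) cas_funpow:
  "cas u (map (\<lambda>i. f ((h ^^ i) u)) [0..<n]) ((h ^^ n) u)"
  if "\<And>i. tail G (f ((h ^^ i) u)) = (h ^^ i) u" "\<And>i. head G (f ((h ^^ i) u)) = h ((h ^^ i) u)"
  using that
proof (induction n arbitrary: u)
  case (Suc n)
  \<comment> \<open>The hypotheses at \<open>h u\<close> are those at \<open>u\<close> with the
    index raised by one.\<close>
  have shift: "(h ^^ i) (h u) = (h ^^ Suc i) u" for i
    by (simp add: funpow_swap1)
  have "cas (h u) (map (\<lambda>i. f ((h ^^ i) (h u))) [0..<n]) ((h ^^ n) (h u))"
    by (rule Suc.IH; unfold shift; rule Suc.prems)
  moreover have "map (\<lambda>i. f ((h ^^ i) u)) [0..<Suc n] = f u # map (\<lambda>i. f ((h ^^ i) (h u))) [0..<n]"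
    by (simp add: map_upt_Suc funpow_swap1 del: upt_Suc)
  ultimately show ?case
    using Suc.prems[of 0] by (simp add: funpow_swap1)
qed simp

text \<open>Converse direction: when every arc of a walk obeys \<open>h\<close>, each tail
  determines the next one, so the walk is forced to run through the iterates of its start.\<close>

lemma (in pre_digraph) tail_nth_cas_funpow:
  assumes "cas u p w" and "\<And>e. e \<in> set p \<Longrightarrow> h (tail G e) = head G e"
  shows "(h ^^ length p) u = w \<and> (\<forall>i<length p. tail G (p ! i) = (h ^^ i) u)"
  using assms
proof (induction p arbitrary: u)
  case (Cons e p)
  then have "tail G e = u" "h u = head G e" "cas (head G e) p w"
    by auto
  with Cons.IH[of "h u"] Cons.prems(2) show ?case
    by (auto simp: funpow_swap1 nth_Cons split: nat.split)
qed simp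

section \<open>Out-arc choices and Hamiltonian cycles\<close>

definition out_arc_choices :: "('a, 'b) pre_digraph \<Rightarrow> ('a \<Rightarrow> 'b) set" where
  "out_arc_choices G = PiE (verts G) (out_arcs G)"

lemma finite_out_arc_choices: "fin_digraph G \<Longrightarrow> finite (out_arc_choices G)"
  unfolding out_arc_choices_def
  by (auto intro!: finite_PiE simp: fin_digraph.finite_out_arcs fin_digraph.finite_verts)

lemma out_arc_choicesD:
  assumes "f \<in> out_arc_choices G" "v \<in> verts G"
  shows "f v \<in> arcs G" "tail G (f v) = v"
  using assms by (auto simp: out_arc_choices_def PiE_iff)

text \<open>The tail of an arc in the image tells at which vertex it was chosen. Thus counting arc
  sets amounts to counting choices.\<close>

lemma inj_on_image_out_arc_choices:
  "inj_on (\<lambda>f. f ` verts G) (out_arc_choices G)"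
proof (rule inj_onI)
  fix f g assume f: "f \<in> out_arc_choices G" and g: "g \<in> out_arc_choices G"
    and eq: "f ` verts G = g ` verts G"
  show "f = g"
  proof (rule PiE_ext[OF f[unfolded out_arc_choices_def] g[unfolded out_arc_choices_def]])
    fix v assume "v \<in> verts G"
    then obtain w where "w \<in> verts G" "f v = g w" using eq by blast
    then show "f v = g v"
      using out_arc_choicesD(2)[OF f \<open>v \<in> verts G\<close>] out_arc_choicesD(2)[OF g, of w] by simp
  qed
qed

text \<open>A Hamiltonian cycle leaves each vertex by exactly one arc, which defines a choice whose
  successor map runs around the cycle. Conversely, iterating a cyclic successor map from any vertex
  traces such a cycle.\<close>

lemma (in fin_digraph) hamiltonian_cycles_eq_cyclic_choices:
  "hamiltonian_cycles G =
    (\<lambda>f. f ` verts G) ` {f \<in> out_arc_choices G. cyclic_on (head G \<circ> f) (verts G)}"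
proof (intro subset_antisym subsetI)
  fix C assume "C \<in> hamiltonian_cycles G"
  then obtain p u where C: "C = set p" and tails: "tail G ` set p = verts G"
    and p: "awalk u p u" "distinct (tl (awalk_verts u p))" "p \<noteq> []"
    by (auto simp: hamiltonian_cycles_def cycle_def)
  have "cas u p u" "set p \<subseteq> arcs G" using p(1) by auto
  have "distinct (map (head G) p)"
    using p by (simp add: awalk_verts_conv'[OF \<open>cas u p u\<close>])
  then have "card (head G ` set p) = length p"
    using distinct_card by fastforce
  then have "length p \<le> card (verts G)"
    using \<open>set p \<subseteq> arcs G\<close> by (metis card_mono finite_verts head_in_verts image_subsetI subsetD)
  \<comment> \<open>The tails cover all vertices, so \<open>card (verts G)\<close>,
    \<open>card (set p)\<close> and \<open>length p\<close> coincide.\<close>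
  then have inj: "inj_on (tail G) (set p)"
    by (intro eq_card_imp_inj_on)
      (auto simp: tails intro: antisym le_trans[OF card_length] card_image_le[of "set p" "tail G", simplified tails])
  \<comment> \<open>\<open>f\<close> assigns to each vertex the unique arc of \<open>p\<close>
    leaving it.\<close>
  define f where "f = (\<lambda>v\<in>verts G. the_inv_into (set p) (tail G) v)"
  have f_tail: "f (tail G e) = e" if "e \<in> set p" for e
    using that tails inj by (auto simp: f_def the_inv_into_f_f)
  have fV: "f ` verts G = set p"
    unfolding tails[symmetric] image_image using f_tail by simp
  have "f \<in> out_arc_choices G"
    unfolding out_arc_choices_def
  proof (rule PiE_I)
    fix v assume "v \<in> verts G"
    then obtain e where "e \<in> set p" "v = tail G e" using tails by blast
    then show "f v \<in> out_arcs G v" using f_tail \<open>set p \<subseteq> arcs G\<close> by auto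
  qed (simp add: f_def)
  moreover have "cyclic_on (head G \<circ> f) (verts G)"
  proof -
    let ?h = "head G \<circ> f"
    have closed: "(?h ^^ length p) u = u" and nth: "\<And>i. i < length p \<Longrightarrow> tail G (p ! i) = (?h ^^ i) u"
      using tail_nth_cas_funpow[OF \<open>cas u p u\<close>, of ?h] f_tail by auto
    \<comment> \<open>The iteration closes up after \<open>length p\<close> steps, so the indices
      below that bound, which are those of the arcs of \<open>p\<close>, give the whole
      orbit.\<close>
    have "orbit ?h u = {(?h ^^ i) u |i. i < length p}"
      using orbit_altdef_bounded[OF closed] p(3) by simp
    also have "\<dots> = tail G ` set p"
      by (auto simp: set_conv_nth nth[symmetric] image_iff) (use nth in metis)+
    finally have "orbit ?h u = verts G" using tails by simp
    moreover have "u \<in> verts G" using p(1) by (simp add: awalk_def)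
    ultimately show ?thesis by (auto simp: cyclic_on_def)
  qed
  ultimately show "C \<in> (\<lambda>f. f ` verts G) ` {f \<in> out_arc_choices G. cyclic_on (head G \<circ> f) (verts G)}"
    using C fV by blast
next
  fix C assume "C \<in> (\<lambda>f. f ` verts G) ` {f \<in> out_arc_choices G. cyclic_on (head G \<circ> f) (verts G)}"
  then obtain f where f: "f \<in> out_arc_choices G" and cyc: "cyclic_on (head G \<circ> f) (verts G)"
    and C: "C = f ` verts G" by blast
  let ?h = "head G \<circ> f"
  from cyc obtain u where u: "u \<in> verts G" "orbit ?h u = verts G"
    by (auto simp: cyclic_on_def)
  \<comment> \<open>\<open>n\<close> is the first positive return time: the iterates below
    \<open>n\<close> are distinct, and \<open>p\<close> is nonempty even if \<open>u\<close> is the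
    only vertex.\<close>
  define n where "n = funpow_dist1 ?h u u"
  define p where "p = map (\<lambda>i. f ((?h ^^ i) u)) [0..<n]"
  have self: "u \<in> orbit ?h u" using u by simp
  have "n > 0" by (simp add: n_def)
  have close: "(?h ^^ n) u = u"
    unfolding n_def using funpow_dist1_prop[OF self] .
  have inV: "(?h ^^ i) u \<in> verts G" for i
    using cyclic_on_funpow_in[OF cyc u(1)] .
  have orb: "(\<lambda>i. (?h ^^ i) u) ` {0..<n} = verts G"
    using orbit_conv_funpow_dist1[OF self] u by (simp add: n_def)
  have set_p: "set p = f ` verts G"
    unfolding p_def orb[symmetric] by (simp add: image_image)
  have "cas u p u"
    using cas_funpow[of f ?h u n] close out_arc_choicesD(2)[OF f inV] by (simp add: p_def)
  moreover have "set p \<subseteq> arcs G"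
    using set_p out_arc_choicesD(1)[OF f] by auto
  ultimately have walk: "awalk u p u" using u by (simp add: awalk_def)
  have "length p = card (verts G)"
    using card_image[OF inj_on_funpow_dist1[OF self]] orb by (simp add: p_def n_def)
  moreover have "set (map (head G) p) = verts G"
  proof -
    have "?h ` verts G = verts G" using cyc by (rule cyclic_on_image_eq)
    then show ?thesis by (simp add: set_p image_image)
  qed
  \<comment> \<open>The list of heads has as many entries as there are vertices and hits them
    all.\<close>
  ultimately have "distinct (map (head G) p)"
    by (intro card_distinct) simp
  moreover have "p \<noteq> []" using \<open>n > 0\<close> by (simp add: p_def)
  ultimately have "cycle p"
    using walk unfolding cycle_def by (auto simp: awalk_verts_conv'[OF \<open>cas u p u\<close>])
  moreover have "tail G ` set p = verts G"
    using set_p out_arc_choicesD(2)[OF f] by (force simp: image_image)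
  ultimately show "C \<in> hamiltonian_cycles G"
    unfolding C set_p[symmetric] hamiltonian_cycles_def by blast
qed

section \<open>From ordered partitions to colourings and arc choices\<close>

text \<open>The blocks are the fibres of the colouring, and the colour of a vertex is the index of
  its block. Both sides are extensional, which makes this a bijection.\<close>

lemma sum_ordered_partitions_eq_sum_colourings:
  "(\<Sum>(Z, Y) \<in> ordered_partitions V K. F Z Y) =
    (\<Sum>c \<in> V \<rightarrow>\<^sub>E {0..K}. F {v \<in> V. c v = 0} (\<lambda>k\<in>{1..K}. {v \<in> V. c v = k}))"
proof -
  define P where "P = (\<lambda>c. ({v \<in> V. c v = (0 :: nat)}, \<lambda>k\<in>{1..K}. {v \<in> V. c v = k}))"
  have "bij_betw P (V \<rightarrow>\<^sub>E {0..K}) (ordered_partitions V K)"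
    unfolding bij_betw_def
  proof (intro conjI subset_antisym subsetI)
    show "inj_on P (V \<rightarrow>\<^sub>E {0..K})"
    proof (rule inj_onI)
      fix c d assume c: "c \<in> V \<rightarrow>\<^sub>E {0..K}" and d: "d \<in> V \<rightarrow>\<^sub>E {0..K}" and eq: "P c = P d"
      show "c = d"
      proof (rule PiE_ext[OF c d])
        fix v assume v: "v \<in> V"
        have Z: "{v \<in> V. c v = 0} = {v \<in> V. d v = 0}"
          and Y: "(\<lambda>k\<in>{1..K}. {v \<in> V. c v = k}) = (\<lambda>k\<in>{1..K}. {v \<in> V. d v = k})"
          using eq by (auto simp: P_def)
        show "c v = d v"
        proof (cases "c v = 0")
          case True
          then show ?thesis using Z v by auto
        next
          case False
          then have "c v \<in> {1..K}" using c v by (auto simp: PiE_iff Suc_le_eq)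
          then have "{w \<in> V. c w = c v} = {w \<in> V. d w = c v}"
            using fun_cong[OF Y, of "c v"] by simp
          then have "v \<in> {w \<in> V. d w = c v}" using v by blast
          then show ?thesis by simp
        qed
      qed
    qed
  next
    fix x assume "x \<in> P ` (V \<rightarrow>\<^sub>E {0..K})"
    then obtain c where c: "c \<in> V \<rightarrow>\<^sub>E {0..K}" and x: "x = P c" by blast
    have "v \<in> (\<Union>k\<in>{1..K}. {v \<in> V. c v = k})" if "v \<in> V" "c v \<noteq> 0" for v
      using that c by (auto simp: PiE_iff Suc_le_eq)
    then show "x \<in> ordered_partitions V K"
      unfolding x P_def ordered_partitions_def
      by (auto simp: disjoint_family_on_def)
  next
    fix x assume "x \<in> ordered_partitions V K"
    then obtain Z Y where x: "x = (Z, Y)" and Z: "Z \<subseteq> V" and Y: "Y \<in> {1..K} \<rightarrow>\<^sub>E Pow V"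
      and disj: "disjoint_family_on Y {1..K}" and ZY: "\<And>k. k \<in> {1..K} \<Longrightarrow> Z \<inter> Y k = {}"
      and un: "Z \<union> (\<Union>k\<in>{1..K}. Y k) = V"
      unfolding ordered_partitions_def by blast
    \<comment> \<open>The index is unique because the \<open>Y k\<close> are disjoint, and it exists
      for vertices outside \<open>Z\<close> because the blocks cover \<open>V\<close>.\<close>
    define c where "c = (\<lambda>v\<in>V. if v \<in> Z then 0 else THE k. k \<in> {1..K} \<and> v \<in> Y k)"
    have c_Y: "c v = k" if "k \<in> {1..K}" "v \<in> Y k" for v k
    proof -
      have "v \<in> V" "v \<notin> Z" using that un ZY by blast+
      moreover have "(THE k. k \<in> {1..K} \<and> v \<in> Y k) = k"
        using that disj unfolding disjoint_family_on_def by (intro the_equality) blast+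
      ultimately show ?thesis by (simp add: c_def)
    qed
    have c_Z: "c v = 0" if "v \<in> Z" for v
      using that Z by (auto simp: c_def)
    have cases: "v \<in> Z \<or> (\<exists>k\<in>{1..K}. v \<in> Y k)" if "v \<in> V" for v
      using that un by blast
    have "{v \<in> V. c v = 0} = Z"
      using cases c_Z c_Y Z by fastforce
    moreover have c_eq_Y: "{v \<in> V. c v = k} = Y k" if "k \<in> {1..K}" for k
    proof (intro subset_antisym subsetI)
      fix v assume "v \<in> {v \<in> V. c v = k}"
      then show "v \<in> Y k" using cases[of v] c_Z[of v] c_Y[of _ v] that by auto
    next
      fix v assume "v \<in> Y k"
      then show "v \<in> {v \<in> V. c v = k}" using that c_Y un by blast
    qed
    moreover have "(\<lambda>k\<in>{1..K}. {v \<in> V. c v = k}) = Y"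
    proof
      fix k show "(\<lambda>k\<in>{1..K}. {v \<in> V. c v = k}) k = Y k"
        using c_eq_Y[of k] PiE_arb[OF Y, of k] by (cases "k \<in> {1..K}") simp_all
    qed
    ultimately have "P c = x" by (simp add: P_def x)
    moreover have "c \<in> V \<rightarrow>\<^sub>E {0..K}"
    proof (rule PiE_I)
      fix v assume "v \<in> V"
      from cases[OF this] show "c v \<in> {0..K}"
      proof
        assume "\<exists>k\<in>{1..K}. v \<in> Y k"
        then obtain k where "k \<in> {1..K}" "v \<in> Y k" by blast
        then show ?thesis using c_Y[of k v] by simp
      qed (simp add: c_Z)
    qed (simp add: c_def)
    ultimately show "x \<in> P ` (V \<rightarrow>\<^sub>E {0..K})" by blast
  qed
  then have "(\<Sum>c \<in> V \<rightarrow>\<^sub>E {0..K}. case P c of (Z, Y) \<Rightarrow> F Z Y) = (\<Sum>(Z, Y) \<in> ordered_partitions V K. F Z Y)"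
    by (rule sum.reindex_bij_betw)
  then show ?thesis by (simp add: P_def)
qed

text \<open>For a fixed colouring every out-degree is a sum over out-arcs of a 0-1 indicator, and
  distributivity turns the product of these sums into a count of compatible choices, all carrying
  the same sign.\<close>

lemma (in fin_digraph) colouring_term_eq_sum_out_arc_choices:
  assumes c: "c \<in> verts G \<rightarrow>\<^sub>E {0..K}"
  defines "Z \<equiv> {v \<in> verts G. c v = 0}" and "Y \<equiv> (\<lambda>k\<in>{1..K}. {v \<in> verts G. c v = k})"
  shows "(- 1) ^ card Z * (\<Prod>z\<in>Z. int (out_deg_into G z (verts G - Z)))
        * (\<Prod>k=1..K. \<Prod>y\<in>Y k. int (out_deg_into G y (Y k)))
    = (\<Sum>f | f \<in> out_arc_choices G \<and> admissible_colouring (verts G) (head G \<circ> f) c.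
        \<Prod>v\<in>verts G. if c v = 0 then - 1 else 1)"
    (is "_ = sum (\<lambda>_. ?w) ?F")
proof -
  let ?V = "verts G"
  \<comment> \<open>One condition covers both kinds of degree: from colour 0 the head must have
    nonzero colour, from colour \<open>k > 0\<close> the head must have colour \<open>k\<close>
    too.\<close>
  let ?ok = "\<lambda>v w. c w \<noteq> 0 \<and> c v \<in> {0, c w}"
  let ?d = "\<lambda>v. \<Sum>e\<in>out_arcs G v. of_bool (?ok v (head G e)) :: int"
  have out_deg: "int (out_deg_into G v X) = ?d v"
    if "\<And>w. w \<in> ?V \<Longrightarrow> w \<in> X \<longleftrightarrow> ?ok v w" for v X
  proof -
    have "{e \<in> arcs G. tail G e = v \<and> head G e \<in> X} = {e \<in> out_arcs G v. ?ok v (head G e)}"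
      using that by auto
    then show ?thesis unfolding out_deg_into_def by (simp only: sum_of_bool_eq_card finite_out_arcs)
  qed
  have V_split: "?V = Z \<union> (\<Union>k\<in>{1..K}. Y k)"
    using c by (fastforce simp: Z_def Y_def PiE_iff)
  have fin: "finite Z" "\<And>k. k \<in> {1..K} \<Longrightarrow> finite (Y k)"
    by (auto simp: Z_def Y_def)
  have prod_split: "prod g ?V = prod g Z * (\<Prod>k=1..K. prod g (Y k))" for g :: "'a \<Rightarrow> int"
  proof -
    have "prod g ?V = prod g Z * prod g (\<Union>k\<in>{1..K}. Y k)"
      by (subst V_split, rule prod.union_disjoint) (use fin in \<open>auto simp: Z_def Y_def\<close>)
    also have "prod g (\<Union>k\<in>{1..K}. Y k) = (\<Prod>k=1..K. prod g (Y k))"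
      by (rule prod.UNION_disjoint) (use fin in \<open>auto simp: Y_def\<close>)
    finally show ?thesis .
  qed
  have "(\<Prod>z\<in>Z. int (out_deg_into G z (verts G - Z))) = (\<Prod>z\<in>Z. ?d z)"
    by (intro prod.cong refl out_deg) (auto simp: Z_def)
  moreover have "(\<Prod>k=1..K. \<Prod>y\<in>Y k. int (out_deg_into G y (Y k))) = (\<Prod>k=1..K. \<Prod>y\<in>Y k. ?d y)"
    by (intro prod.cong refl out_deg) (auto simp: Y_def)
  moreover have "?w = (- 1) ^ card Z"
  proof -
    have "(\<Prod>v\<in>Z. if c v = 0 then - 1 else (1::int)) = (\<Prod>v\<in>Z. - 1)"
      by (rule prod.cong) (auto simp: Z_def)
    moreover have "(\<Prod>k=1..K. \<Prod>v\<in>Y k. if c v = 0 then - 1 else (1::int)) = 1"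
      by (intro prod.neutral ballI) (auto simp: Y_def)
    ultimately show ?thesis by (simp add: prod_split)
  qed
  moreover have "(\<Prod>v\<in>?V. ?d v) = int (card ?F)"
  proof -
    have "(\<Prod>v\<in>?V. ?d v) =
        (\<Sum>f\<in>out_arc_choices G. \<Prod>v\<in>?V. of_bool (?ok v (head G (f v))))"
      unfolding out_arc_choices_def by (rule prod_sum_PiE) auto
    also have "\<dots> = (\<Sum>f\<in>out_arc_choices G. of_bool (admissible_colouring ?V (head G \<circ> f) c))"
    proof (rule sum.cong[OF refl])
      fix f
      show "(\<Prod>v\<in>?V. of_bool (?ok v (head G (f v)))) =
          (of_bool (admissible_colouring ?V (head G \<circ> f) c) :: int)"
        by (cases "admissible_colouring ?V (head G \<circ> f) c")
          (auto simp: admissible_colouring_def intro!: prod.neutral)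
    qed
    also have "\<dots> = int (card ?F)"
      by (rule sum_of_bool_eq_card) (rule finite_out_arc_choices[OF fin_digraph_axioms])
    finally show ?thesis .
  qed
  ultimately show ?thesis by (simp add: prod_split mult_ac)
qed

text \<open>After interchanging the sums, the colourings are summed for a fixed choice: the result
  is 0 unless the successor map is onto, and otherwise a power of \<open>K\<close>.\<close>

lemma (in fin_digraph) sum_ordered_partitions_eq_sum_powers:
  "(\<Sum>(Z, Y) \<in> ordered_partitions (verts G) K.
        (- 1) ^ card Z
        * (\<Prod>z\<in>Z. int (out_deg_into G z (verts G - Z)))
        * (\<Prod>k=1..K. \<Prod>y\<in>Y k. int (out_deg_into G y (Y k)))) =
    (\<Sum>f | f \<in> out_arc_choices G \<and> (head G \<circ> f) ` verts G = verts G.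
        int K ^ card (orbit (perm_restrict (head G \<circ> f) (verts G)) ` verts G))"
proof -
  let ?V = "verts G"
  let ?w = "\<lambda>c. \<Prod>v\<in>?V. if c v = (0::nat) then - 1 else (1 :: int)"
  let ?T = "\<lambda>f. \<Sum>c | c \<in> ?V \<rightarrow>\<^sub>E {0..K} \<and> admissible_colouring ?V (head G \<circ> f) c. ?w c"
  let ?S = "{f \<in> out_arc_choices G. (head G \<circ> f) ` ?V = ?V}"
  note fin = finite_out_arc_choices[OF fin_digraph_axioms]
  have T_0: "?T f = 0" if f: "f \<in> out_arc_choices G" and nsurj: "(head G \<circ> f) ` ?V \<noteq> ?V" for f
  proof -
    have "head G \<circ> f \<in> ?V \<rightarrow> ?V" using out_arc_choicesD[OF f] by auto
    moreover from this obtain l where "l \<in> ?V" "l \<notin> (head G \<circ> f) ` ?V" using nsurj by blast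
    ultimately show ?thesis by (intro sum_admissible_eq_0) auto
  qed
  have T_power: "?T f = int K ^ card (orbit (perm_restrict (head G \<circ> f) ?V) ` ?V)"
    if surj: "(head G \<circ> f) ` ?V = ?V" for f
  proof -
    let ?h = "perm_restrict (head G \<circ> f) ?V"
    have "?h permutes ?V" using finite_verts surj by (rule perm_restrict_permutes)
    \<comment> \<open>Admissibility evaluates the successor map only on vertices, where restricting
      changes nothing.\<close>
    moreover have "admissible_colouring ?V (head G \<circ> f) c = admissible_colouring ?V ?h c" for c
      by (simp add: admissible_colouring_def perm_restrict_def)
    ultimately show ?thesis using sum_admissible_eq_power[of ?V ?h K] by simp
  qed
  have "(\<Sum>(Z, Y) \<in> ordered_partitions (verts G) K.
        (- 1) ^ card Z
        * (\<Prod>z\<in>Z. int (out_deg_into G z (verts G - Z)))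
        * (\<Prod>k=1..K. \<Prod>y\<in>Y k. int (out_deg_into G y (Y k)))) =
      (\<Sum>c\<in>?V \<rightarrow>\<^sub>E {0..K}. \<Sum>f | f \<in> out_arc_choices G \<and> admissible_colouring ?V (head G \<circ> f) c. ?w c)"
    unfolding sum_ordered_partitions_eq_sum_colourings
    by (intro sum.cong refl colouring_term_eq_sum_out_arc_choices)
  \<comment> \<open>The range of \<open>f\<close> depends on \<open>c\<close>, so the swap has to
    carry the compatibility condition along.\<close>
  also have "\<dots> = (\<Sum>f\<in>out_arc_choices G. ?T f)"
    using fin by (intro sum.swap_restrict) (auto intro: finite_PiE)
  also have "\<dots> = (\<Sum>f\<in>?S. ?T f)"
    using fin T_0 by (intro sum.mono_neutral_right) auto
  also have "\<dots> = (\<Sum>f\<in>?S. int K ^ card (orbit (perm_restrict (head G \<circ> f) ?V) ` ?V))"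
    by (intro sum.cong refl T_power) auto
  finally show ?thesis .
qed

section \<open>Division by \<open>K\<close> and reduction modulo \<open>K\<close>\<close>

theorem theorem3:
  fixes G :: "('a, 'b) pre_digraph" and K :: nat
  assumes "fin_digraph G"
    and "verts G \<noteq> {}"
    and "K \<ge> 2"
  shows "\<exists>q :: int.
    (\<Sum>(Z, Y) \<in> ordered_partitions (verts G) K.
        (- 1) ^ card Z
        * (\<Prod>z\<in>Z. int (out_deg_into G z (verts G - Z)))
        * (\<Prod>k=1..K. \<Prod>y\<in>Y k. int (out_deg_into G y (Y k)))) = int K * q
    \<and> [int (card (hamiltonian_cycles G)) = q] (mod int K)"
proof -
  interpret fin_digraph G by fact
  let ?V = "verts G"
  let ?h = "\<lambda>f. perm_restrict (head G \<circ> f) ?V"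
  let ?m = "\<lambda>f. card (orbit (?h f) ` ?V)"
  let ?S = "{f \<in> out_arc_choices G. (head G \<circ> f) ` ?V = ?V}"
  let ?C = "{f \<in> out_arc_choices G. cyclic_on (head G \<circ> f) ?V}"
  \<comment> \<open>One factor \<open>K\<close> is removed from each summand. This is exact since a
    nonempty vertex set has at least one orbit, so the truncated subtraction is harmless.\<close>
  define q where "q = (\<Sum>f\<in>?S. int K ^ (?m f - 1))"
  note fin = finite_out_arc_choices[OF assms(1)]
  have m_pos: "?m f > 0" for f
    using assms(2) by (simp add: card_gt_0_iff)
  have "(\<Sum>f\<in>?S. int K ^ ?m f) = int K * q"
    unfolding q_def sum_distrib_left
    by (intro sum.cong refl, subst power_Suc[symmetric]) (use m_pos in simp)
  moreover have "[int (card (hamiltonian_cycles G)) = q] (mod int K)"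
  proof -
    have cyc_surj: "(head G \<circ> f) ` ?V = ?V" if "cyclic_on (head G \<circ> f) ?V" for f
      using that by (rule cyclic_on_image_eq)
    have "card (hamiltonian_cycles G) = card ?C"
      unfolding hamiltonian_cycles_eq_cyclic_choices
      by (rule card_image) (rule inj_on_subset[OF inj_on_image_out_arc_choices], auto)
    also have "int (card ?C) = (\<Sum>f\<in>?S. of_bool (cyclic_on (head G \<circ> f) ?V))"
    proof -
      have "?C = {f \<in> ?S. cyclic_on (head G \<circ> f) ?V}" using cyc_surj by blast
      then show ?thesis using fin by (simp only: sum_of_bool_eq_card finite_Collect_conjI simp_thms Collect_mem_eq)
    qed
    also have "[\<dots> = q] (mod int K)"
      unfolding q_def
    proof (rule cong_sum)
      fix f assume "f \<in> ?S"
      then have "?h f permutes ?V" by (intro perm_restrict_permutes) auto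
      then have "?m f = 1 \<longleftrightarrow> cyclic_on (head G \<circ> f) ?V"
        using card_orbits_eq_1_iff[OF finite_verts] cyclic_on_perm_restrict by blast
      \<comment> \<open>The exponent is 0 exactly for cyclic choices, which contribute 1; every
        higher power vanishes modulo \<open>K\<close>.\<close>
      then show "[of_bool (cyclic_on (head G \<circ> f) ?V) = int K ^ (?m f - 1)] (mod int K)"
        using m_pos[of f] by (cases "?m f - 1") (auto simp: cong_0_iff cong_sym_eq[of 0])
    qed
    finally show ?thesis .
  qed
  ultimately show ?thesis
    using sum_ordered_partitions_eq_sum_powers[of K] by auto
qed

end
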